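(* Let $P=\langle Q,\mathrm{Instrs},\delta\rangle$ be a single process, let $\mathcal{G}^\iota=\langle C,C_A,C_B,\to\rangle$ be the TSO game of the single-process program $\langle P\rangle$, and let $\mathcal{G}^{\mathcal V}=\langle \mathcal V,\mathcal V_A,\mathcal V_B,\to_{\mathrm{view}}\rangle$ be the view game. Then the relation $R=\{(c,\mathrm{view}(c))\mid c\in C\}$ is a bisimulation between $\mathcal{G}^\iota$ and $\mathcal{G}^{\mathcal V}$ with respect to the colourings $\lambda^\iota:C\to\mathcal V$, $c\mapsto\mathrm{view}(c)$, and $\lambda^{\mathcal V}=\mathrm{id}_{\mathcal V}$.
   Context: Let $V$ be a finite data domain and $X$ a finite set of shared variables over $V$. Instructions $\mathrm{Instrs}$ are $\mathrm{rd}(x,d)$, $\mathrm{wr}(x,d)$ ($x\in X,d\in V$), $\mathrm{skip}$, $\mathrm{mf}$. For a single process, a TSO configuration is $c=\langle q,b,m\rangle$ with $q\in Q$, buffer $b\in(X\times V)^*$ (new messages added on the left, oldest on the right) and memory $m:X\to V$. Transitions: $\mathrm{rd}(x,d)$ along an edge $q\xrightarrow{\mathrm{rd}(x,d)}q'$ is enabled if the most recent buffer message on $x$ is $\langle x,d\rangle$, or if there is no buffer message on $x$ and $m(x)=d$; $\mathrm{wr}(x,d)$ moves to $q'$ and prepends $\langle x,d\rangle$ to $b$; $\mathrm{skip}$ only changes the state; $\mathrm{mf}$ is enabled only if $b=\varepsilon$; an update removes the oldest message $\langle x,d\rangle$ from $b$ and sets $m(x)=d$. $c\xrightarrow{\mathrm{up}^*}c'$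 means zero or more updates. The TSO game $\mathcal{G}^\iota$: $C_A=\{c_A\}$, $C_B=\{c_B\}$ are copies of the configurations, $C=C_A\cup C_B$; the process player moves $c_A\xrightarrow{i}c'_B$ for each instruction transition $c\xrightarrow{i}c'$; the update player moves $c_B\xrightarrow{\mathrm{up}^*}c'_A$ whenever $c\xrightarrow{\mathrm{up}^*}c'$. The view of $c=\langle q,b,m\rangle$ is $\mathrm{view}(c)=\langle q,\mathrm{val},f\rangle$, where $\mathrm{val}(x)=d$ if the most recent message on $x$ in $b$ is $\langle x,d\rangle$ and $\mathrm{val}(x)=m(x)$ if there is none, and $f=\mathrm{true}$ iff $b=\varepsilon$. Extend to game configurations by $\mathrm{view}(c_X)=\mathrm{view}(c)_X$ for $X\in\{A,B\}$. The view game: $\mathcal V_X=\{\mathrm{view}(c)_X\}$, $\mathcal V=\mathcal V_A\cup\mathcal V_B$, and $v\xrightarrow{\lambda}_{\mathrm{view}}v'$ iff there are game configurations $c,c'$ of $\mathcal{G}^\iota$ with $\mathrm{view}(c)=v$, $\mathrm{view}(c')=v'$ and $c\xrightarrow{\lambda}c'$. Given games $\mathcal G,\mathcal G'$ with colourings $\lambda,\lambda'$ (functions from configurations to a set of colours), a bisimulation is a relation $R\subseteq C\times C'$ such that for all $(c_1,c_2)\in R$: $\lambda(c_1)=\lambda'(c_2)$; for every transition $c_1\xrightarrow{l}c_3$ there is $c_2\xrightarrow{l}c_4$ with $(c_3,c_4)\in R$; and for every transition $c_2\xrightarrow{l}c_4$ there is $c_1\xrightarrow{l}c_3$ with $(c_3,c_4)\in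 R$. *)

theory Defs
  imports Main "HOL-Library.FuncSet"
begin

section \<open>Games, colourings, bisimulations\<close>

record ('c, 'l) game =
  confs :: "'c set"
  confs_A :: "'c set"
  confs_B :: "'c set"
  moves :: "('c \<times> 'l \<times> 'c) set"

definition bisimulation ::
  "('c, 'l) game \<Rightarrow> ('d, 'l) game \<Rightarrow> ('c \<Rightarrow> 'k) \<Rightarrow> ('d \<Rightarrow> 'k) \<Rightarrow> ('c \<times> 'd) set \<Rightarrow> bool"
where
  "bisimulation G G' col col' R \<longleftrightarrow>
     R \<subseteq> confs G \<times> confs G' \<and>
     (\<forall>(c1, c2) \<in> R.
        col c1 = col' c2 \<and>
        (\<forall>l c3. (c1, l, c3) \<in> moves G \<longrightarrow> (\<exists>c4. (c2, l, c4) \<in> moves G' \<and> (c3, c4) \<in> R)) \<and>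
        (\<forall>l c4. (c2, l, c4) \<in> moves G' \<longrightarrow> (\<exists>c3. (c1, l, c3) \<in> moves G \<and> (c3, c4) \<in> R)))"


section \<open>Processes under TSO\<close>

datatype ('x, 'v) instr = Rd 'x 'v | Wr 'x 'v | Skip | Mf

definition instrs :: "'x set \<Rightarrow> 'v set \<Rightarrow> ('x, 'v) instr set" where
  "instrs X V = {Rd x d | x d. x \<in> X \<and> d \<in> V} \<union> {Wr x d | x d. x \<in> X \<and> d \<in> V} \<union> {Skip, Mf}"

record ('q, 'x, 'v) process =
  states :: "'q set"
  edges :: "('q \<times> ('x, 'v) instr \<times> 'q) set"

definition is_process :: "'x set \<Rightarrow> 'v set \<Rightarrow> ('q, 'x, 'v) process \<Rightarrow> bool" where
  "is_process X V P \<longleftrightarrow> edges P \<subseteq> states P \<times> instrs X V \<times> states P"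

text \<open>
  A configuration is a triple of local state, buffer and memory. The head of the buffer list
  is the newest message and its last element the oldest one. Hence \<open>map_of b x\<close> is the value of
  the most recent message on \<open>x\<close>, or \<open>None\<close> if the buffer holds no message on \<open>x\<close>.
\<close>

type_synonym ('q, 'x, 'v) config = "'q \<times> ('x \<times> 'v) list \<times> ('x \<Rightarrow> 'v)"

text \<open>
  Memories are extensional functions, so that two memories with the same values on the
  shared variables are equal.
\<close>

definition tso_configs :: "'x set \<Rightarrow> 'v set \<Rightarrow> ('q, 'x, 'v) process \<Rightarrow> ('q, 'x, 'v) config set" where
  "tso_configs X V P = states P \<times> lists (X \<times> V) \<times> (X \<rightarrow>\<^sub>E V)"

inductive instr_step ::
  "('q, 'x, 'v) process \<Rightarrow> ('q, 'x, 'v) config \<Rightarrow> ('x, 'v) instr \<Rightarrow> ('q, 'x, 'v) config \<Rightarrow> bool"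
  for P
where
  read: "(q, Rd x d, q') \<in> edges P \<Longrightarrow> map_of b x = Some d \<or> map_of b x = None \<and> m x = d
     \<Longrightarrow> instr_step P (q, b, m) (Rd x d) (q', b, m)"
| "write": "(q, Wr x d, q') \<in> edges P \<Longrightarrow> instr_step P (q, b, m) (Wr x d) (q', (x, d) # b, m)"
| skip: "(q, Skip, q') \<in> edges P \<Longrightarrow> instr_step P (q, b, m) Skip (q', b, m)"
| fence: "(q, Mf, q') \<in> edges P \<Longrightarrow> b = [] \<Longrightarrow> instr_step P (q, b, m) Mf (q', b, m)"

inductive update_step :: "('q, 'x, 'v) config \<Rightarrow> ('q, 'x, 'v) config \<Rightarrow> bool" where
  "update_step (q, b @ [(x, d)], m) (q, b, m(x := d))"


section \<open>The TSO game\<close>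

text \<open>
  The copies \<open>c\<^sub>A\<close> and \<open>c\<^sub>B\<close> of a configuration are \<open>(c, A)\<close> and \<open>(c, B)\<close>; the process player
  moves in \<open>A\<close>, the update player in \<open>B\<close>. All moves of the update player carry the
  same label \<open>Ups\<close>, irrespective of the number of updates performed.
\<close>

datatype player = A | B

datatype ('x, 'v) label = Ins "('x, 'v) instr" | Ups

definition tso_game ::
  "'x set \<Rightarrow> 'v set \<Rightarrow> ('q, 'x, 'v) process \<Rightarrow> (('q, 'x, 'v) config \<times> player, ('x, 'v) label) game"
where
  "tso_game X V P =
    \<lparr>confs = tso_configs X V P \<times> {A} \<union> tso_configs X V P \<times> {B},
     confs_A = tso_configs X V P \<times> {A},
     confs_B = tso_configs X V P \<times> {B},
     moves =
       {((c, A), Ins i, (c', B)) | c i c'.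
          c \<in> tso_configs X V P \<and> c' \<in> tso_configs X V P \<and> instr_step P c i c'} \<union>
       {((c, B), Ups, (c', A)) | c c'.
          c \<in> tso_configs X V P \<and> c' \<in> tso_configs X V P \<and> update_step\<^sup>*\<^sup>* c c'}\<rparr>"


section \<open>The view game\<close>

type_synonym ('q, 'x, 'v) view = "'q \<times> ('x \<Rightarrow> 'v) \<times> bool"

fun view :: "('q, 'x, 'v) config \<Rightarrow> ('q, 'x, 'v) view" where
  "view (q, b, m) = (q, (\<lambda>x. case map_of b x of Some d \<Rightarrow> d | None \<Rightarrow> m x), b = [])"

fun game_view :: "('q, 'x, 'v) config \<times> player \<Rightarrow> ('q, 'x, 'v) view \<times> player" where
  "game_view (c, p) = (view c, p)"

definition view_game ::
  "'x set \<Rightarrow> 'v set \<Rightarrow> ('q, 'x, 'v) process \<Rightarrow> (('q, 'x, 'v) view \<times> player, ('x, 'v) label) game"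
where
  "view_game X V P =
    \<lparr>confs = game_view ` confs_A (tso_game X V P) \<union> game_view ` confs_B (tso_game X V P),
     confs_A = game_view ` confs_A (tso_game X V P),
     confs_B = game_view ` confs_B (tso_game X V P),
     moves = {(v, l, v'). \<exists>c c'. c \<in> confs (tso_game X V P) \<and> c' \<in> confs (tso_game X V P) \<and>
       game_view c = v \<and> game_view c' = v' \<and> (c, l, c') \<in> moves (tso_game X V P)}\<rparr>"

end

theory Submission
  imports Defs
begin

text \<open>
  An update never changes the state or the visible values, only possibly the emptiness flag, and
  a buffer can always be drained completely. So a move of the update player is matched from any
  configuration with the same view: by draining if the buffer is empty afterwards, and by doing
  nothing otherwise. Whether an instruction is enabled, and the view it leads to, depend only on
  the current view.
\<close>

text \<open>In the graph of \<open>h\<close> the partner of each configuration is forced, so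
  matching moves reduces to \<open>h\<close> preserving them and to every move out of
  \<open>h c\<close> lifting to one out of \<open>c\<close>.\<close>

lemma bisimulation_graphI:
  assumes "\<And>c. c \<in> confs G \<Longrightarrow> h c \<in> confs G'"
    and "\<And>c. c \<in> confs G \<Longrightarrow> col c = col' (h c)"
    and "\<And>c l c'. c \<in> confs G \<Longrightarrow> (c, l, c') \<in> moves G \<Longrightarrow>
           c' \<in> confs G \<and> (h c, l, h c') \<in> moves G'"
    and "\<And>c l d. c \<in> confs G \<Longrightarrow> (h c, l, d) \<in> moves G' \<Longrightarrow>
           \<exists>c'. c' \<in> confs G \<and> (c, l, c') \<in> moves G \<and> h c' = d"
  shows "bisimulation G G' col col' {(c, h c) | c. c \<in> confs G}"
  unfolding bisimulation_def using assms by (auto; metis)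

lemma instr_step_tso_configs:
  assumes "instr_step P c i c'" "is_process X V P" "c \<in> tso_configs X V P"
  shows "c' \<in> tso_configs X V P"
  using assms by cases (auto simp: tso_configs_def is_process_def instrs_def)

text \<open>The flushed message comes from a well-typed buffer, so the memory changes only at a
  variable in \<open>X\<close> and stays extensional.\<close>

lemma update_step_tso_configs:
  assumes "update_step c c'" "c \<in> tso_configs X V P"
  shows "c' \<in> tso_configs X V P"
  using assms by cases (auto simp: tso_configs_def PiE_iff extensional_def)

lemma updates_tso_configs:
  assumes "update_step\<^sup>*\<^sup>* c c'" "c \<in> tso_configs X V P"
  shows "c' \<in> tso_configs X V P"
  using assms by induction (auto intro: update_step_tso_configs)

text \<open>The flushed message is the oldest. If a newer one on \<open>x\<close> remains, it hides
  the memory before and after; otherwise the memory receives exactly the value that was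
  visible.\<close>

lemma update_step_view:
  assumes "update_step c c'"
  shows "fst (view c') = fst (view c)" "fst (snd (view c')) = fst (snd (view c))"
  using assms by (cases; auto simp: map_add_def split: option.splits)+

lemma updates_view:
  assumes "update_step\<^sup>*\<^sup>* c c'"
  shows "fst (view c') = fst (view c)" "fst (snd (view c')) = fst (snd (view c))"
  using assms by (induction) (auto simp: update_step_view)

lemma updates_drain: "\<exists>m'. update_step\<^sup>*\<^sup>* (q, b, m) (q, [], m')"
\<comment> \<open>Updates take messages from the right end, hence the reverse induction; each one
  changes the memory, hence the arbitrary \<open>m\<close>.\<close>
proof (induction b arbitrary: m rule: rev_induct)
  case (snoc p b)
  obtain x d where "p = (x, d)" by fastforce
  then show ?case
    using snoc by (meson converse_rtranclp_into_rtranclp update_step.intros)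
qed blast

text \<open>The flag says that the buffer of \<open>c\<close> is empty, and an update needs a
  message to remove, so only zero updates are possible.\<close>

lemma updates_empty_buffer:
  assumes "update_step\<^sup>*\<^sup>* c c'" "snd (snd (view c))"
  shows "c' = c"
  using assms by (induction) (auto elim!: update_step.cases)

lemma updates_view_simulation:
  assumes eq: "view c\<^sub>1 = view c\<^sub>2" and ups: "update_step\<^sup>*\<^sup>* c\<^sub>1 c\<^sub>3"
  shows "\<exists>c\<^sub>4. update_step\<^sup>*\<^sup>* c\<^sub>2 c\<^sub>4 \<and> view c\<^sub>4 = view c\<^sub>3"
proof (cases "snd (snd (view c\<^sub>3))")
  case True
  obtain q b m where c2: "c\<^sub>2 = (q, b, m)" using prod_cases3 by blast
  obtain m' where drain: "update_step\<^sup>*\<^sup>* c\<^sub>2 (q, [], m')"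
    using updates_drain[of q b m] c2 by auto
  \<comment> \<open>State and values survive both update sequences, and both flags are true at the
    end.\<close>
  moreover have "view (q, [], m') = view c\<^sub>3"
    using updates_view[OF drain] updates_view[OF ups] eq True by (simp add: prod_eq_iff)
  ultimately show ?thesis by blast
next
  case False
  \<comment> \<open>An empty buffer would have stayed empty. So the flag is false throughout, and
    \<open>c\<^sub>2\<close> itself serves as the witness.\<close>
  then have "\<not> snd (snd (view c\<^sub>1))"
    using updates_empty_buffer[OF ups] by blast
  then have "view c\<^sub>2 = view c\<^sub>3"
    using updates_view[OF ups] eq False by (simp add: prod_eq_iff)
  then show ?thesis by blast
qed

text \<open>The left side is the premise of \<open>instr_step.read\<close>, so enabledness of a read
  transfers between configurations with equal views.\<close>

lemma instr_step_read_iff_view: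
  "(map_of b x = Some d \<or> map_of b x = None \<and> m x = d) \<longleftrightarrow> fst (snd (view (q, b, m))) x = d"
  by (auto split: option.splits)

text \<open>The new message hides all older ones on \<open>x\<close>; thus the view after a write is
  computed from the view before it.\<close>

lemma view_write:
  "view (q', (x, d) # b, m) = (q', (fst (snd (view (q, b, m))))(x := d), False)"
  by auto

lemma instr_step_view_simulation:
  assumes eq: "view c\<^sub>1 = view c\<^sub>2" and step: "instr_step P c\<^sub>1 i c\<^sub>3"
  shows "\<exists>c\<^sub>4. instr_step P c\<^sub>2 i c\<^sub>4 \<and> view c\<^sub>4 = view c\<^sub>3"
proof -
  obtain q b m where c2: "c\<^sub>2 = (q, b, m)" using prod_cases3 by blast
  from step show ?thesis
  proof cases
    case (read p x d q' b1 m1)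
    then have "fst (snd (view (q, b, m))) x = d"
      using eq c2 read instr_step_read_iff_view[of b1 x d m1 p] by metis
    moreover have "p = q"
      using eq c2 read by simp
    ultimately have "instr_step P c\<^sub>2 i (q', b, m)"
      unfolding c2 \<open>i = Rd x d\<close>
      using read instr_step_read_iff_view[of b x d m q] by (intro instr_step.read) blast+
    then show ?thesis using eq c2 read by auto
  next
    case ("write" p x d q' b1 m1)
    then have "instr_step P c\<^sub>2 i (q', (x, d) # b, m)"
      using eq c2 by (auto intro: instr_step.write)
    moreover have "view (q', (x, d) # b, m) = view c\<^sub>3"
      using eq c2 "write" view_write[of q' x d b m q] view_write[of q' x d b1 m1 p] by simp
    ultimately show ?thesis by blast
  next
    case (skip p q' b1 m1)
    then have "instr_step P c\<^sub>2 i (q', b, m)"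
      using eq c2 by (auto intro: instr_step.skip)
    then show ?thesis using eq c2 skip by auto
  next
    case (fence p q' b1 m1)
    then have "instr_step P c\<^sub>2 i (q', b, m)"
      using eq c2 by (auto intro: instr_step.fence)
    then show ?thesis using eq c2 fence by auto
  qed
qed

lemma moves_view_simulation:
  assumes proc: "is_process X V P"
    and c2: "c\<^sub>2 \<in> confs (tso_game X V P)"
    and eq: "game_view c\<^sub>1 = game_view c\<^sub>2"
    and move: "(c\<^sub>1, l, c\<^sub>3) \<in> moves (tso_game X V P)"
  shows "\<exists>c\<^sub>4. (c\<^sub>2, l, c\<^sub>4) \<in> moves (tso_game X V P) \<and> game_view c\<^sub>4 = game_view c\<^sub>3"
proof -
  obtain c p where cp: "c\<^sub>2 = (c, p)" by fastforce
  then have c: "c \<in> tso_configs X V P"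
    using c2 by (auto simp: tso_game_def)
  \<comment> \<open>The player tag of \<open>c\<^sub>1\<close> decides the kind of move, and by
    \<open>eq\<close> the tag of \<open>c\<^sub>2\<close> is the same.\<close>
  from move consider
    (instr) c1 i c3 where "c\<^sub>1 = (c1, A)" "l = Ins i" "c\<^sub>3 = (c3, B)" "instr_step P c1 i c3"
  | (updates) c1 c3 where "c\<^sub>1 = (c1, B)" "l = Ups" "c\<^sub>3 = (c3, A)" "update_step\<^sup>*\<^sup>* c1 c3"
    by (auto simp: tso_game_def)
  then show ?thesis
  proof cases
    case instr
    then obtain c4 where "instr_step P c i c4" "view c4 = view c3"
      using instr_step_view_simulation[of c1 c P i c3] eq cp by auto
    then show ?thesis
      using instr eq cp c instr_step_tso_configs[OF _ proc c]
      by (intro exI[of _ "(c4, B)"]) (simp add: tso_game_def del: split_paired_Ex)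
  next
    case updates
    then obtain c4 where "update_step\<^sup>*\<^sup>* c c4" "view c4 = view c3"
      using updates_view_simulation[of c1 c c3] eq cp by auto
    then show ?thesis
      using updates eq cp c updates_tso_configs[OF _ c]
      by (intro exI[of _ "(c4, A)"]) (simp add: tso_game_def del: split_paired_Ex)
  qed
qed

lemma moves_confs:
  assumes "(c, l, c') \<in> moves (tso_game X V P)"
  shows "c \<in> confs (tso_game X V P)" "c' \<in> confs (tso_game X V P)"
  using assms by (auto simp: tso_game_def)

lemma moves_view_game_iff:
  "(v, l, v') \<in> moves (view_game X V P) \<longleftrightarrow>
     (\<exists>c c'. game_view c = v \<and> game_view c' = v' \<and> (c, l, c') \<in> moves (tso_game X V P))"
  using moves_confs by (fastforce simp: view_game_def)

lemma confs_view_game: "confs (view_game X V P) = game_view ` confs (tso_game X V P)"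
  by (simp add: view_game_def tso_game_def image_Un)

theorem theorem2:
  fixes X :: "'x set" and V :: "'v set" and P :: "('q, 'x, 'v) process"
  assumes "finite X" and "finite V" and "is_process X V P"
  shows "bisimulation (tso_game X V P) (view_game X V P) game_view id
           {(c, game_view c) | c. c \<in> confs (tso_game X V P)}"
proof (rule bisimulation_graphI)
  fix c l c'
  assume "(c, l, c') \<in> moves (tso_game X V P)"
  then show "c' \<in> confs (tso_game X V P) \<and>
      (game_view c, l, game_view c') \<in> moves (view_game X V P)"
    using moves_confs(2) unfolding moves_view_game_iff by blast
next
  fix c l v
  assume "c \<in> confs (tso_game X V P)" "(game_view c, l, v) \<in> moves (view_game X V P)"
  \<comment> \<open>The view move may stem from a configuration other than \<open>c\<close>, but one
    with the same view; the simulation carries its move over to \<open>c\<close>.\<close>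
  then show "\<exists>c'. c' \<in> confs (tso_game X V P) \<and> (c, l, c') \<in> moves (tso_game X V P) \<and>
      game_view c' = v"
    using moves_view_simulation[OF assms(3)] moves_confs(2) unfolding moves_view_game_iff
    by metis
qed (simp_all only: confs_view_game id_apply imageI)

end
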